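(* Let $D=(V,A)$ be a loop-free digraph with a weight function $w:A\to\mathbb{R}_+\cup\{+\infty\}$ and let $g:V\to\mathbb{R}_+\cup\{+\infty\}$. The problem of deciding whether there is an ordering of $V$ with $\delta^{\ell}_w(v)\le g(v)$ for every $v\in V$ (the $(-\infty,g;\sum w)$-bounded ordering problem), and finding such an ordering if one exists, is solvable in polynomial time. Such an ordering exists if and only if $D$ has no nonempty induced subgraph $D'=(V',A')$ such that $\delta_w(v,V'\setminus\{v\})>g(v)$ holds for each vertex $v\in V'$.
   Context: Digraphs are finite and loop-free; parallel arcs are allowed. $\mathbb{R}_+$ denotes the nonnegative reals. For $v\in V$ and $U\subseteq V$, $\delta_w(v,U)$ is the sum of the weights $w(a)$ over all arcs $a$ from $v$ to vertices of $U$. For an ordering $\sigma=(\sigma_1,\dots,\sigma_n)$ of $V$ and $v=\sigma_i$, the weighted left-outdegree is $\delta^{\ell}_w(v)=\delta_w(v,\{\sigma_1,\dots,\sigma_{i-1}\})$. *)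

theory Defs
  imports
    "Graph_Theory.Digraph_Component"
    "HOL-Library.Extended_Nonnegative_Real"
    "HOL-Computational_Algebra.Polynomial"
begin

section \<open>Bounded orderings\<close>

definition wdeg :: "('a, 'b) pre_digraph \<Rightarrow> ('b \<Rightarrow> ennreal) \<Rightarrow> 'a \<Rightarrow> 'a set \<Rightarrow> ennreal" where
  "wdeg D w v U = (\<Sum>a \<in> {a \<in> arcs D. tail D a = v \<and> head D a \<in> U}. w a)"

definition is_ordering :: "'a set \<Rightarrow> 'a list \<Rightarrow> bool" where
  "is_ordering V \<sigma> \<longleftrightarrow> distinct \<sigma> \<and> set \<sigma> = V"

definition left_wdeg :: "('a, 'b) pre_digraph \<Rightarrow> ('b \<Rightarrow> ennreal) \<Rightarrow> 'a list \<Rightarrow> 'a \<Rightarrow> ennreal" where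
  "left_wdeg D w \<sigma> v = wdeg D w v (set (takeWhile (\<lambda>u. u \<noteq> v) \<sigma>))"

text \<open>The lower bound is minus infinity for every vertex, so only the upper bound appears.\<close>

definition bounded_ordering ::
  "('a, 'b) pre_digraph \<Rightarrow> ('b \<Rightarrow> ennreal) \<Rightarrow> ('a \<Rightarrow> ennreal) \<Rightarrow> 'a list \<Rightarrow> bool" where
  "bounded_ordering D w g \<sigma> \<longleftrightarrow>
     is_ordering (verts D) \<sigma> \<and> (\<forall>v \<in> verts D. left_wdeg D w \<sigma> v \<le> g v)"


section \<open>A random access machine over the extended nonnegative reals\<close>

text \<open>
  Weights are arbitrary reals (or infinite), so running time is the number of elementary steps of
  a random access machine whose memory holds natural numbers (for indices) and, separately,
  elements of \<^typ>\<open>ennreal\<close>. Both memories consist of arrays with indirect addressing; the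
  array itself is named by a constant of the program, so each program uses finitely many arrays.

  Elements of \<^typ>\<open>ennreal\<close> can only be copied, added and compared, and natural
  numbers only be copied, added, subtracted and compared. In particular there is no multiplication
  and no rounding: one step lengthens the binary representations of the numbers involved by at
  most a bounded number of bits, so on rational inputs polynomially many steps of this machine
  amount to polynomial time in the bit model.
\<close>

record mem =
  nmem :: "nat \<Rightarrow> nat \<Rightarrow> nat"
  vmem :: "nat \<Rightarrow> nat \<Rightarrow> ennreal"

datatype nexp =
    NConst nat
  | NGet nat nexp
  | NAdd nexp nexp
  | NSub nexp nexp

datatype vexp =
    VZero
  | VGet nat nexp
  | VAdd vexp vexp

datatype test =
    NLe nexp nexp
  | VLe vexp vexp
  | TNot test
  | TAnd test test

datatype com =
    Skip
  | NSet nat nexp nexp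
  | VSet nat nexp vexp
  | Seq com com
  | Cond test com com
  | While test com

primrec nval :: "nexp \<Rightarrow> mem \<Rightarrow> nat" where
  "nval (NConst k) s = k"
| "nval (NGet x e) s = nmem s x (nval e s)"
| "nval (NAdd e f) s = nval e s + nval f s"
| "nval (NSub e f) s = nval e s - nval f s"

primrec vval :: "vexp \<Rightarrow> mem \<Rightarrow> ennreal" where
  "vval VZero s = 0"
| "vval (VGet x e) s = vmem s x (nval e s)"
| "vval (VAdd e f) s = vval e s + vval f s"

primrec tval :: "test \<Rightarrow> mem \<Rightarrow> bool" where
  "tval (NLe e f) s \<longleftrightarrow> nval e s \<le> nval f s"
| "tval (VLe e f) s \<longleftrightarrow> vval e s \<le> vval f s"
| "tval (TNot b) s \<longleftrightarrow> \<not> tval b s"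
| "tval (TAnd b c) s \<longleftrightarrow> tval b s \<and> tval c s"

text \<open>Evaluating an expression costs one step per operation occurring in it.\<close>

primrec ncost :: "nexp \<Rightarrow> nat" where
  "ncost (NConst k) = 1"
| "ncost (NGet x e) = 1 + ncost e"
| "ncost (NAdd e f) = 1 + ncost e + ncost f"
| "ncost (NSub e f) = 1 + ncost e + ncost f"

primrec vcost :: "vexp \<Rightarrow> nat" where
  "vcost VZero = 1"
| "vcost (VGet x e) = 1 + ncost e"
| "vcost (VAdd e f) = 1 + vcost e + vcost f"

primrec tcost :: "test \<Rightarrow> nat" where
  "tcost (NLe e f) = 1 + ncost e + ncost f"
| "tcost (VLe e f) = 1 + vcost e + vcost f"
| "tcost (TNot b) = 1 + tcost b"
| "tcost (TAnd b c) = 1 + tcost b + tcost c"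

definition nstore :: "nat \<Rightarrow> nat \<Rightarrow> nat \<Rightarrow> mem \<Rightarrow> mem" where
  "nstore x i k s = s\<lparr>nmem := (nmem s)(x := (nmem s x)(i := k))\<rparr>"

definition vstore :: "nat \<Rightarrow> nat \<Rightarrow> ennreal \<Rightarrow> mem \<Rightarrow> mem" where
  "vstore x i r s = s\<lparr>vmem := (vmem s)(x := (vmem s x)(i := r))\<rparr>"

text \<open>\<open>exec c s t s'\<close>: started in \<open>s\<close>, the program \<open>c\<close> halts in \<open>s'\<close> after \<open>t\<close> steps.\<close>

inductive exec :: "com \<Rightarrow> mem \<Rightarrow> nat \<Rightarrow> mem \<Rightarrow> bool" where
  Skip: "exec Skip s 1 s"
| NSet: "exec (NSet x i e) s (1 + ncost i + ncost e) (nstore x (nval i s) (nval e s) s)"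
| VSet: "exec (VSet x i e) s (1 + ncost i + vcost e) (vstore x (nval i s) (vval e s) s)"
| Seq: "exec c s t s' \<Longrightarrow> exec d s' u s'' \<Longrightarrow> exec (Seq c d) s (t + u) s''"
| CondTrue: "tval b s \<Longrightarrow> exec c s t s' \<Longrightarrow> exec (Cond b c d) s (1 + tcost b + t) s'"
| CondFalse: "\<not> tval b s \<Longrightarrow> exec d s t s' \<Longrightarrow> exec (Cond b c d) s (1 + tcost b + t) s'"
| WhileFalse: "\<not> tval b s \<Longrightarrow> exec (While b c) s (1 + tcost b) s"
| WhileTrue: "tval b s \<Longrightarrow> exec c s t s' \<Longrightarrow> exec (While b c) s' u s''
    \<Longrightarrow> exec (While b c) s (1 + tcost b + t + u) s''"

inductive_cases exec_SkipE: "exec Skip s t s'"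
inductive_cases exec_NSetE: "exec (NSet x i e) s t s'"
inductive_cases exec_VSetE: "exec (VSet x i e) s t s'"
inductive_cases exec_SeqE: "exec (Seq c d) s t s'"
inductive_cases exec_CondE: "exec (Cond b c d) s t s'"
inductive_cases exec_WhileE: "exec (While b c) s t s'"

lemma exec_deterministic:
  "exec c s t s' \<Longrightarrow> exec c s u s'' \<Longrightarrow> u = t \<and> s'' = s'"
proof (induction arbitrary: u s'' rule: exec.induct)
  case (Seq c s t s' d v s1)
  from Seq.prems show ?case by (rule exec_SeqE) (metis Seq.IH)
next
  case (CondTrue b s c t s' d)
  from CondTrue.prems show ?case
    by (rule exec_CondE) (use CondTrue.hyps in \<open>auto dest: CondTrue.IH\<close>)
next
  case (CondFalse b s d t s' c)
  from CondFalse.prems show ?case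
    by (rule exec_CondE) (use CondFalse.hyps in \<open>auto dest: CondFalse.IH\<close>)
next
  case (WhileFalse b s c)
  from WhileFalse.prems show ?case
    by (rule exec_WhileE) (use WhileFalse.hyps in auto)
next
  case (WhileTrue b s c t s' v s1)
  from WhileTrue.prems show ?case
    by (rule exec_WhileE) (use WhileTrue.hyps in \<open>auto dest: WhileTrue.IH\<close>)
qed (auto elim: exec_SkipE exec_NSetE exec_VSetE)

text \<open>
  The input is stored in array 0 of each memory; everything else is initially zero. The answer is
  read off from the memory of natural numbers: cell 0 of array 1 tells whether there is an answer,
  cell 1 of array 1 is its length, and array 2 holds its entries.
\<close>

type_synonym input = "nat list \<times> ennreal list"

definition initial_mem :: "input \<Rightarrow> mem" where
  "initial_mem x =
     \<lparr>nmem = (\<lambda>b i. if b = 0 \<and> i < length (fst x) then fst x ! i else 0),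
      vmem = (\<lambda>b i. if b = 0 \<and> i < length (snd x) then snd x ! i else 0)\<rparr>"

definition answer :: "mem \<Rightarrow> nat list option" where
  "answer s = (if nmem s 1 0 = 0 then None else Some (map (nmem s 2) [0..<nmem s 1 1]))"

definition input_size :: "input \<Rightarrow> nat" where
  "input_size x = length (fst x) + length (snd x)"

text \<open>
  A search problem is given by its instances, their encoding as inputs, and the set of solutions
  of each instance. A single program has to decide whether a solution exists and to find one if so.
\<close>

definition solvable_in_polynomial_time ::
  "'i set \<Rightarrow> ('i \<Rightarrow> input) \<Rightarrow> ('i \<Rightarrow> nat list set) \<Rightarrow> bool" where
  "solvable_in_polynomial_time I enc Sol \<longleftrightarrow>
     (\<exists>(c :: com) (p :: nat poly). \<forall>x \<in> I. \<exists>t s.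
        exec c (initial_mem (enc x)) t s \<and> t \<le> poly p (input_size (enc x)) \<and>
        (case answer s of None \<Rightarrow> Sol x = {} | Some \<sigma> \<Rightarrow> \<sigma> \<in> Sol x))"


section \<open>The bounded ordering problem\<close>

text \<open>
  As part of an input, a finite digraph has its vertices and its arcs numbered from 0. It is
  given by its numbers of vertices and arcs and the lists of tails and heads of the arcs, followed
  by the weights of the arcs and the bounds of the vertices.
\<close>

type_synonym ordering_instance = "(nat, nat) pre_digraph \<times> (nat \<Rightarrow> ennreal) \<times> (nat \<Rightarrow> ennreal)"

definition ordering_instances :: "ordering_instance set" where
  "ordering_instances = {(D, w, g). fin_digraph D \<and> loopfree_digraph D \<and>
     verts D = {..<card (verts D)} \<and> arcs D = {..<card (arcs D)}}"

definition encode_instance :: "ordering_instance \<Rightarrow> input" where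
  "encode_instance = (\<lambda>(D, w, g).
     let n = card (verts D); m = card (arcs D) in
       ([n, m] @ map (tail D) [0..<m] @ map (head D) [0..<m], map w [0..<m] @ map g [0..<n]))"

definition bounded_orderings :: "ordering_instance \<Rightarrow> nat list set" where
  "bounded_orderings = (\<lambda>(D, w, g). {\<sigma>. bounded_ordering D w g \<sigma>})"

end

theory Submission
  imports Defs
begin

text \<open>
  The ordering is built from its right end. A vertex \<open>v\<close> may stand last among the vertices of a
  set \<open>U\<close> if and only if \<open>wdeg D w v U \<le> g v\<close>, and which vertex of this kind is chosen does not
  matter: the condition only becomes weaker when \<open>U\<close> shrinks. Either this peeling exhausts the
  vertex set, and the peeled vertices form a bounded ordering
  (\<open>peeling_imp_bounded_ordering\<close>), or it gets stuck at a nonempty set \<open>U\<close> in which every vertex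
  violates its bound. The subgraph induced by \<open>U\<close> then excludes bounded orderings: the vertex of
  \<open>U\<close> that comes last in an ordering has all other vertices of \<open>U\<close> on its left
  (\<open>bounded_ordering_imp_not_obstructed\<close>).

  The same peeling is the algorithm. The program scans the vertices downwards for one that can be
  peeled, and starts the scan afresh after each success. If \<open>k\<close> vertices are left and the scan
  is at vertex \<open>v\<close>, then \<open>k * (n + 1) + v\<close> decreases in every step of the scan, so there are
  at most \<open>n * (n + 1) + n\<close> steps, each of which takes time linear in the number of arcs. Running
  times are tracked by a total correctness calculus (\<open>runs\<close>) whose triples carry a bound on the
  number of steps.
\<close>

section \<open>Peeling off vertices from the right\<close>

lemma wdeg_mono:
  assumes "finite (arcs D)" "U \<subseteq> U'"
  shows "wdeg D w v U \<le> wdeg D w v U'"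
  unfolding wdeg_def by (rule sum_mono2) (use assms in auto)

lemma wdeg_remove_self:
  assumes "loopfree_digraph D"
  shows "wdeg D w v (U - {v}) = wdeg D w v U"
proof -
  have "head D a \<noteq> tail D a" if "a \<in> arcs D" for a
    using loopfree_digraph.no_loops[OF assms that] by simp
  then have "{a \<in> arcs D. tail D a = v \<and> head D a \<in> U - {v}} =
      {a \<in> arcs D. tail D a = v \<and> head D a \<in> U}"
    by auto
  then show ?thesis by (simp add: wdeg_def)
qed

text \<open>
  The list \<open>ys\<close> is a possible final segment of a bounded ordering, as far as the bounds of its own
  entries are concerned: each entry respects its bound when all vertices not following it are put
  to its left. (The entry itself is among these vertices, which is immaterial without loops.)
\<close>

primrec peeling :: "('a, 'b) pre_digraph \<Rightarrow> ('b \<Rightarrow> ennreal) \<Rightarrow> ('a \<Rightarrow> ennreal) \<Rightarrow> 'a list \<Rightarrow> bool" where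
  "peeling D w g [] \<longleftrightarrow> True"
| "peeling D w g (v # ys) \<longleftrightarrow>
     v \<in> verts D - set ys \<and> wdeg D w v (verts D - set ys) \<le> g v \<and> peeling D w g ys"

lemma peeling_append: "peeling D w g (xs @ ys) \<Longrightarrow> peeling D w g ys"
  by (induction xs) auto

lemma peeling_distinct: "peeling D w g ys \<Longrightarrow> distinct ys \<and> set ys \<subseteq> verts D"
  by (induction ys) auto

lemma peeling_imp_bounded_ordering:
  assumes "finite (arcs D)" and p: "peeling D w g \<sigma>" and V: "set \<sigma> = verts D"
  shows "bounded_ordering D w g \<sigma>"
  unfolding bounded_ordering_def is_ordering_def
proof (intro conjI ballI)
  show d: "distinct \<sigma>" and "set \<sigma> = verts D"
    using peeling_distinct[OF p] V by auto
  fix v assume "v \<in> verts D"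
  then obtain xs ys where \<sigma>: "\<sigma> = xs @ v # ys"
    using V by (metis split_list)
  have left: "takeWhile (\<lambda>u. u \<noteq> v) \<sigma> = xs"
    using d \<sigma> by (subst \<sigma>, subst takeWhile_tail) (auto simp: takeWhile_eq_all_conv)
  have "left_wdeg D w \<sigma> v \<le> wdeg D w v (verts D - set ys)"
    unfolding left_wdeg_def left
    by (rule wdeg_mono[OF assms(1)]) (use d V \<sigma> in auto)
  also have "\<dots> \<le> g v"
    using p unfolding \<sigma> by (auto dest: peeling_append)
  finally show "left_wdeg D w \<sigma> v \<le> g v" .
qed

lemma bounded_ordering_imp_not_obstructed:
  assumes fin: "finite (arcs D)" and \<sigma>: "bounded_ordering D w g \<sigma>"
    and U: "U \<subseteq> verts D" "U \<noteq> {}"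
  shows "\<exists>v \<in> U. wdeg D w v (U - {v}) \<le> g v"
proof -
  have "\<exists>x \<in> set \<sigma>. x \<in> U"
    using \<sigma> U by (auto simp: bounded_ordering_def is_ordering_def)
  from split_list_last_prop[OF this] obtain xs v zs
    where split: "\<sigma> = xs @ v # zs" "v \<in> U" "\<forall>z \<in> set zs. z \<notin> U"
    by blast
  have "v \<notin> set xs"
    using \<sigma> split by (auto simp: bounded_ordering_def is_ordering_def)
  then have left: "takeWhile (\<lambda>u. u \<noteq> v) \<sigma> = xs"
    by (subst split, subst takeWhile_tail) (auto simp: takeWhile_eq_all_conv)
  have "wdeg D w v (U - {v}) \<le> left_wdeg D w \<sigma> v"
    unfolding left_wdeg_def left
    by (rule wdeg_mono[OF fin])
      (use \<sigma> U split in \<open>auto simp: bounded_ordering_def is_ordering_def\<close>)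
  also have "\<dots> \<le> g v"
    using \<sigma> U split by (auto simp: bounded_ordering_def)
  finally show ?thesis using split by blast
qed

lemma bounded_ordering_if_unobstructed:
  assumes fin: "finite (verts D)" "finite (arcs D)"
    and unobstructed: "\<And>U. U \<subseteq> verts D \<Longrightarrow> U \<noteq> {} \<Longrightarrow> \<exists>v \<in> U. wdeg D w v U \<le> g v"
  shows "\<exists>\<sigma>. bounded_ordering D w g \<sigma>"
proof -
  have "k \<le> card (verts D) \<Longrightarrow> \<exists>ys. peeling D w g ys \<and> length ys = k" for k
  proof (induction k)
    case (Suc k)
    then obtain ys where ys: "peeling D w g ys" "length ys = k"
      by auto
    have "card (set ys) < card (verts D)"
      using Suc.prems ys card_length[of ys] by simp
    then have "verts D - set ys \<noteq> {}"
      using card_mono[of "set ys" "verts D"] by auto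
    then obtain v where "v \<in> verts D - set ys" "wdeg D w v (verts D - set ys) \<le> g v"
      using unobstructed[of "verts D - set ys"] by blast
    then have "peeling D w g (v # ys) \<and> length (v # ys) = Suc k"
      using ys by simp
    then show ?case by blast
  qed auto
  then obtain \<sigma> where \<sigma>: "peeling D w g \<sigma>" "length \<sigma> = card (verts D)"
    by blast
  then have "set \<sigma> = verts D"
    using peeling_distinct[OF \<sigma>(1)] fin by (metis card_subset_eq distinct_card)
  then show ?thesis
    using peeling_imp_bounded_ordering fin \<sigma> by blast
qed

theorem bounded_ordering_iff:
  assumes "fin_digraph D" and "loopfree_digraph D"
  shows "(\<exists>\<sigma>. bounded_ordering D w g \<sigma>) \<longleftrightarrow>
      \<not> (\<exists>D'. induced_subgraph D' D \<and> verts D' \<noteq> {} \<and>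
            (\<forall>v \<in> verts D'. wdeg D w v (verts D' - {v}) > g v))"
    (is "_ \<longleftrightarrow> \<not> ?obstructed")
proof
  interpret fin_digraph D by fact
  assume "\<exists>\<sigma>. bounded_ordering D w g \<sigma>"
  then obtain \<sigma> where \<sigma>: "bounded_ordering D w g \<sigma>" ..
  show "\<not> ?obstructed"
  proof
    assume ?obstructed
    then obtain D' where D': "induced_subgraph D' D" "verts D' \<noteq> {}"
      "\<forall>v \<in> verts D'. wdeg D w v (verts D' - {v}) > g v" by blast
    moreover have "verts D' \<subseteq> verts D"
      using D'(1) by (auto simp: induced_subgraph_def subgraph_def)
    ultimately show False
      using bounded_ordering_imp_not_obstructed[OF finite_arcs \<sigma>] by (metis leD)
  qed
next
  interpret fin_digraph D by fact
  assume "\<not> ?obstructed"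
  show "\<exists>\<sigma>. bounded_ordering D w g \<sigma>"
  proof (rule bounded_ordering_if_unobstructed)
    fix U assume U: "U \<subseteq> verts D" "U \<noteq> {}"
    have "induced_subgraph (D \<restriction> U) D"
      using U by (intro induced_induce)
    then show "\<exists>v \<in> U. wdeg D w v U \<le> g v"
      using \<open>\<not> ?obstructed\<close> U
      by (auto simp: wdeg_remove_self[OF assms(2)] not_less)
  qed auto
qed


section \<open>Total correctness with time bounds\<close>

text \<open>Started in \<open>s\<close>, the program halts after at most \<open>T\<close> steps in a state that satisfies \<open>Q\<close>.\<close>

definition runs :: "com \<Rightarrow> mem \<Rightarrow> nat \<Rightarrow> (mem \<Rightarrow> bool) \<Rightarrow> bool" where
  "runs c s T Q \<longleftrightarrow> (\<exists>t s'. exec c s t s' \<and> t \<le> T \<and> Q s')"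

lemma runs_weaken:
  assumes "runs c s T Q" "T \<le> T'" "\<And>s'. Q s' \<Longrightarrow> Q' s'"
  shows "runs c s T' Q'"
  using assms unfolding runs_def by (meson order_trans)

lemma runs_time: "runs c s T Q \<Longrightarrow> T \<le> T' \<Longrightarrow> runs c s T' Q"
  by (rule runs_weaken)

lemma runs_Skip: "Q s \<Longrightarrow> runs Skip s 1 Q"
  unfolding runs_def using exec.Skip by blast

lemma runs_NSet:
  "Q (nstore x (nval i s) (nval e s) s) \<Longrightarrow> runs (NSet x i e) s (1 + ncost i + ncost e) Q"
  unfolding runs_def using exec.NSet by blast

lemma runs_VSet:
  "Q (vstore x (nval i s) (vval e s) s) \<Longrightarrow> runs (VSet x i e) s (1 + ncost i + vcost e) Q"
  unfolding runs_def using exec.VSet by blast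

lemma runs_Seq:
  assumes "runs c s T (\<lambda>s'. runs d s' U Q)"
  shows "runs (Seq c d) s (T + U) Q"
  using assms unfolding runs_def by (meson exec.Seq add_mono)

lemma runs_Cond:
  assumes "tval b s \<Longrightarrow> runs c s T Q" "\<not> tval b s \<Longrightarrow> runs d s U Q"
  shows "runs (Cond b c d) s (1 + tcost b + T + U) Q"
proof (cases "tval b s")
  case True
  then obtain t s' where "exec c s t s'" "t \<le> T" "Q s'"
    using assms(1) by (auto simp: runs_def)
  then show ?thesis
    using exec.CondTrue[OF True, of c t s' d] unfolding runs_def
    by (intro exI[of _ "1 + tcost b + t"] exI[of _ s']) auto
next
  case False
  then obtain t s' where "exec d s t s'" "t \<le> U" "Q s'"
    using assms(2) by (auto simp: runs_def)
  then show ?thesis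
    using exec.CondFalse[OF False, of d t s' c] unfolding runs_def
    by (intro exI[of _ "1 + tcost b + t"] exI[of _ s']) auto
qed

text \<open>
  A loop that preserves \<open>I\<close> and decreases \<open>\<mu>\<close> is executed at most \<open>N\<close> times when \<open>\<mu>\<close> starts
  below \<open>N + 1\<close>; the additional \<open>1 + tcost b\<close> pays for the final, failing test.
\<close>

lemma runs_While:
  fixes \<mu> :: "mem \<Rightarrow> nat"
  assumes step: "\<And>s. I s \<Longrightarrow> tval b s \<Longrightarrow> runs c s T (\<lambda>s'. I s' \<and> \<mu> s' < \<mu> s)"
    and "I s" "\<mu> s \<le> N"
  shows "runs (While b c) s (N * (1 + tcost b + T) + (1 + tcost b)) (\<lambda>s'. I s' \<and> \<not> tval b s')"
  using assms(2,3)
proof (induction N arbitrary: s)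
  case 0
  then have "\<not> tval b s"
    using step[of s] by (auto simp: runs_def)
  then show ?case
    using exec.WhileFalse 0 unfolding runs_def by fastforce
next
  case (Suc N)
  show ?case
  proof (cases "tval b s")
    case True
    from step[OF Suc.prems(1) this] obtain t s' where
      body: "exec c s t s'" "t \<le> T" "I s'" "\<mu> s' < \<mu> s"
      by (auto simp: runs_def)
    have "\<mu> s' \<le> N"
      using body Suc.prems by simp
    from Suc.IH[OF body(3) this] obtain u s'' where
      rest: "exec (While b c) s' u s''" "u \<le> N * (1 + tcost b + T) + (1 + tcost b)"
        "I s''" "\<not> tval b s''"
      by (auto simp: runs_def)
    have "1 + tcost b + t + u \<le> Suc N * (1 + tcost b + T) + (1 + tcost b)"
      using body(2) rest(2) by simp
    then show ?thesis
      using exec.WhileTrue[OF True body(1) rest(1)] rest unfolding runs_def by blast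
  next
    case False
    then show ?thesis
      using exec.WhileFalse[OF False, of c] Suc.prems unfolding runs_def
      by (intro exI[of _ "1 + tcost b"] exI[of _ s]) auto
  qed
qed


section \<open>The program\<close>

text \<open>
  Arrays of natural numbers: 0, 1 and 2 hold the input and the answer; cell \<open>u\<close> of array 3 is
  nonzero once vertex \<open>u\<close> has been peeled off; cell 0 of the arrays 4, 5 and 6 holds the vertex
  \<open>v\<close> to be examined, an arc \<open>a\<close>, and the number \<open>k\<close> of vertices left. Cell 0 of array 1 of the
  memory of weights accumulates the weighted outdegree of \<open>v\<close>.
\<close>

abbreviation scalar :: "nat \<Rightarrow> nexp" where
  "scalar x \<equiv> NGet x (NConst 0)"

text \<open>Moves on to the next lower arc and adds its weight if it leads from \<open>v\<close> to a vertex left over.\<close>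

definition sum_step :: com where
  "sum_step =
     Seq (NSet 5 (NConst 0) (NSub (scalar 5) (NConst 1)))
    (Cond (TAnd (TAnd (NLe (NGet 0 (NAdd (NConst 2) (scalar 5))) (scalar 4))
                      (NLe (scalar 4) (NGet 0 (NAdd (NConst 2) (scalar 5)))))
                (NLe (NGet 3 (NGet 0 (NAdd (NAdd (NConst 2) (NGet 0 (NConst 1))) (scalar 5)))) (NConst 0)))
       (VSet 1 (NConst 0) (VAdd (VGet 1 (NConst 0)) (VGet 0 (scalar 5))))
       Skip)"

text \<open>Computes the weighted outdegree of \<open>v\<close> into the set of vertices left over.\<close>

definition sum_arcs :: com where
  "sum_arcs =
     Seq (VSet 1 (NConst 0) VZero)
    (Seq (NSet 5 (NConst 0) (NGet 0 (NConst 1)))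
         (While (NLe (NConst 1) (scalar 5)) sum_step))"

text \<open>
  Puts \<open>v\<close> at the last free position \<open>k - 1\<close> of the answer and restarts the scan at \<open>n\<close>, since
  vertices that were rejected before may have become admissible.
\<close>

definition peel_vertex :: com where
  "peel_vertex =
     Seq (NSet 3 (scalar 4) (NConst 1))
    (Seq (NSet 6 (NConst 0) (NSub (scalar 6) (NConst 1)))
    (Seq (NSet 2 (scalar 6) (scalar 4))
         (NSet 4 (NConst 0) (scalar 0))))"

text \<open>
  The current vertex is the one below the value found in \<open>v\<close>, so that the scan is over when \<open>v\<close>
  is 0.
\<close>

definition examine_vertex :: com where
  "examine_vertex =
     Seq (NSet 4 (NConst 0) (NSub (scalar 4) (NConst 1)))
    (Cond (NLe (NGet 3 (scalar 4)) (NConst 0))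
       (Seq sum_arcs
            (Cond (VLe (VGet 1 (NConst 0)) (VGet 0 (NAdd (NGet 0 (NConst 1)) (scalar 4))))
               peel_vertex
               Skip))
       Skip)"

text \<open>An answer is declared only if the scan has ended with no vertex left over.\<close>

definition find_ordering :: com where
  "find_ordering =
     Seq (NSet 6 (NConst 0) (scalar 0))
    (Seq (NSet 4 (NConst 0) (scalar 0))
    (Seq (While (NLe (NConst 1) (scalar 4)) examine_vertex)
         (Cond (NLe (scalar 6) (NConst 0))
            (Seq (NSet 1 (NConst 0) (NConst 1))
                 (NSet 1 (NConst 1) (scalar 0)))
            Skip)))"


section \<open>Correctness and running time of the program\<close>

lemma nmem_nstore: "nmem (nstore x i k s) y j = (if y = x \<and> j = i then k else nmem s y j)"
  by (simp add: nstore_def)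

lemma nmem_nstore_other: "y \<noteq> x \<Longrightarrow> nmem (nstore x i k s) y = nmem s y"
  by (simp add: nstore_def)

lemma nmem_vstore: "nmem (vstore x i r s) = nmem s"
  by (simp add: vstore_def)

lemma vmem_nstore: "vmem (nstore x i k s) = vmem s"
  by (simp add: nstore_def)

lemma vmem_vstore: "vmem (vstore x i r s) y j = (if y = x \<and> j = i then r else vmem s y j)"
  by (simp add: vstore_def)

lemmas mem_simps = nmem_nstore nmem_vstore vmem_nstore vmem_vstore

text \<open>The digraphs that occur in instances: \<open>n\<close> vertices and \<open>m\<close> arcs, both numbered from 0.\<close>

locale numbered_digraph = fin_digraph D + loopfree_digraph D
  for D :: "(nat, nat) pre_digraph" +
  fixes w :: "nat \<Rightarrow> ennreal" and g :: "nat \<Rightarrow> ennreal" and n m :: nat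
  assumes verts_eq: "verts D = {..<n}" and arcs_eq: "arcs D = {..<m}"
begin

text \<open>The arrays 0 contain the encoded instance, cell by cell.\<close>

definition holds_input :: "mem \<Rightarrow> bool" where
  "holds_input s \<longleftrightarrow> nmem s 0 0 = n \<and> nmem s 0 1 = m \<and>
     (\<forall>a<m. nmem s 0 (2 + a) = tail D a \<and> nmem s 0 (2 + m + a) = head D a \<and> vmem s 0 a = w a) \<and>
     (\<forall>v<n. vmem s 0 (m + v) = g v)"

lemma holds_input_initial: "holds_input (initial_mem (encode_instance (D, w, g)))"
  by (auto simp: holds_input_def initial_mem_def encode_instance_def verts_eq arcs_eq Let_def
      nth_append nth_Cons')

lemma input_size_eq: "input_size (encode_instance (D, w, g)) = 2 + 3 * m + n"
  by (simp add: input_size_def encode_instance_def verts_eq arcs_eq Let_def)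

text \<open>The part of the weighted outdegree of \<open>v\<close> into \<open>U\<close> due to the arcs numbered from \<open>a\<close> on.\<close>

definition tail_sum :: "nat \<Rightarrow> nat set \<Rightarrow> nat \<Rightarrow> ennreal" where
  "tail_sum v U a = (\<Sum>b \<in> {a..<m}. if tail D b = v \<and> head D b \<in> U then w b else 0)"

lemma tail_sum_0: "tail_sum v U 0 = wdeg D w v U"
  unfolding tail_sum_def wdeg_def arcs_eq
  by (subst sum.inter_filter[symmetric]) (auto intro: sum.cong)

text \<open>
  The states agree in all that the scan relies on, that is, up to the arc counter and the
  accumulated weight (and further arrays of weights, which are never read).
\<close>

definition same_except_sum :: "mem \<Rightarrow> mem \<Rightarrow> bool" where
  "same_except_sum s s' \<longleftrightarrow> (\<forall>x. x \<noteq> 5 \<longrightarrow> nmem s' x = nmem s x) \<and> vmem s' 0 = vmem s 0"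

text \<open>The vertices not marked as peeled off.\<close>

definition left_over :: "mem \<Rightarrow> nat set" where
  "left_over s = {u. u < n \<and> nmem s 3 u = 0}"

text \<open>
  Invariant of the summation started in state \<open>s\<close>: in state \<open>s'\<close> the arcs from the arc counter on
  have been accounted for.
\<close>

definition arc_inv :: "mem \<Rightarrow> mem \<Rightarrow> bool" where
  "arc_inv s s' \<longleftrightarrow> same_except_sum s s' \<and> nmem s' 5 0 \<le> m \<and>
     vmem s' 1 0 = tail_sum (nmem s 4 0) (left_over s) (nmem s' 5 0)"

text \<open>
  The numerical constants in this and the following time bounds are upper bounds for the total
  costs of loop-free program parts; nothing depends on their precise values.
\<close>

lemma runs_sum_step:
  assumes input: "holds_input s" and inv: "arc_inv s s'" and pos: "nmem s' 5 0 = Suc a"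
  shows "runs sum_step s' 45 (\<lambda>s''. arc_inv s s'' \<and> nmem s'' 5 0 = a)"
proof -
  have a: "a < m"
    using inv pos by (auto simp: arc_inv_def)
  then have head: "head D a < n"
    using head_in_verts[of a] by (simp add: verts_eq arcs_eq)
  have sum: "tail_sum v U a =
      (if tail D a = v \<and> head D a \<in> U then w a else 0) + tail_sum v U (Suc a)" for v U
    unfolding tail_sum_def using a by (simp add: sum.atLeast_Suc_lessThan)
  have same: "\<And>x. x \<noteq> 5 \<Longrightarrow> nmem s' x = nmem s x" "vmem s' 0 = vmem s 0"
    using inv by (auto simp: arc_inv_def same_except_sum_def)
  have vals: "nmem s 0 (Suc 0) = m" "nmem s 0 (Suc (Suc a)) = tail D a"
      "nmem s 0 (Suc (Suc (m + a))) = head D a" "vmem s 0 a = w a"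
      "vmem s' (Suc 0) 0 = tail_sum (nmem s 4 0) (left_over s) (Suc a)"
    using input a inv pos by (auto simp: holds_input_def arc_inv_def)
  show ?thesis
    unfolding sum_step_def
    apply (rule runs_time)
     apply (rule runs_Seq, rule runs_NSet, (rule runs_Cond; rule runs_VSet runs_Skip))
     apply (use pos a head in \<open>simp_all add: mem_simps same vals arc_inv_def same_except_sum_def fun_eq_iff sum\<close>)
     apply (auto simp: left_over_def add.commute)
    done
qed

lemma runs_sum_arcs:
  assumes input: "holds_input s"
  shows "runs sum_arcs s (60 * m + 60) (\<lambda>s'. same_except_sum s s' \<and>
    vmem s' 1 0 = wdeg D w (nmem s 4 0) (left_over s))"
proof -
  have start: "arc_inv s (nstore 5 0 m (vstore 1 0 0 s))"
    by (auto simp: arc_inv_def same_except_sum_def mem_simps fun_eq_iff tail_sum_def)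
  have loop: "runs (While (NLe (NConst 1) (scalar 5)) sum_step) (nstore 5 0 m (vstore 1 0 0 s))
      (m * (1 + tcost (NLe (NConst 1) (scalar 5)) + 45) + (1 + tcost (NLe (NConst 1) (scalar 5))))
      (\<lambda>s'. arc_inv s s' \<and> \<not> tval (NLe (NConst 1) (scalar 5)) s')"
  proof (rule runs_While[where \<mu> = "\<lambda>s. nmem s 5 0"])
    fix s' assume "arc_inv s s'" "tval (NLe (NConst 1) (scalar 5)) s'"
    moreover from this obtain a where "nmem s' 5 0 = Suc a"
      by (cases "nmem s' 5 0") auto
    ultimately show "runs sum_step s' 45 (\<lambda>s''. arc_inv s s'' \<and> nmem s'' 5 0 < nmem s' 5 0)"
      by (auto intro: runs_weaken[OF runs_sum_step[OF input]])
  qed (use start in \<open>auto simp: mem_simps\<close>)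
  have "nmem s 0 1 = m"
    using input by (simp add: holds_input_def)
  show ?thesis
    unfolding sum_arcs_def
    apply (rule runs_time)
     apply (rule runs_Seq runs_VSet runs_NSet)+
     apply (simp only: nval.simps vval.simps mem_simps \<open>nmem s 0 1 = m\<close>)
     apply (rule runs_weaken[OF loop order_refl])
     apply (auto simp: arc_inv_def not_le tail_sum_0)
    done
qed

text \<open>The entries of the answer array from position \<open>k\<close> on: the vertices peeled off so far.\<close>

definition peeled :: "mem \<Rightarrow> nat list" where
  "peeled s = map (nmem s 2) [nmem s 6 0..<n]"

text \<open>
  Invariant of the scan: the vertices peeled off form a peeling, and among the vertices left over,
  all that are at least \<open>v\<close> violate their bounds. At \<open>v = n\<close> the latter is void, and at \<open>v = 0\<close> it
  makes the vertices left over an obstruction, unless there are none.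
\<close>

definition scan_inv :: "mem \<Rightarrow> bool" where
  "scan_inv s \<longleftrightarrow> holds_input s \<and> nmem s 1 0 = 0 \<and> nmem s 4 0 \<le> n \<and> nmem s 6 0 \<le> n \<and>
     peeling D w g (peeled s) \<and> left_over s = {..<n} - set (peeled s) \<and>
     (\<forall>u\<in>left_over s. nmem s 4 0 \<le> u \<longrightarrow> g u < wdeg D w u (left_over s))"

lemma same_except_sum_simps:
  assumes "same_except_sum s s'"
  shows "left_over s' = left_over s" "holds_input s' = holds_input s" "peeled s' = peeled s"
    "x \<noteq> 5 \<Longrightarrow> nmem s' x = nmem s x" "vmem s' 0 = vmem s 0"
  using assms by (simp_all add: same_except_sum_def holds_input_def left_over_def peeled_def)

lemma scan_inv_same: "scan_inv s \<Longrightarrow> same_except_sum s s' \<Longrightarrow> scan_inv s'"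
  by (auto simp: scan_inv_def same_except_sum_simps)

text \<open>
  The factor \<open>n + 1\<close> makes a decrease of \<open>k\<close> outweigh the reset of \<open>v\<close> to \<open>n\<close>.
\<close>

definition potential :: "mem \<Rightarrow> nat" where
  "potential s = nmem s 6 0 * (n + 1) + nmem s 4 0"

lemma runs_peel_vertex:
  assumes input: "holds_input s" "nmem s 1 0 = 0" and v: "nmem s 4 0 = v" "v \<in> left_over s"
    and peeled: "nmem s 6 0 \<le> n" "peeling D w g (peeled s)" "left_over s = {..<n} - set (peeled s)"
    and bound: "wdeg D w v (left_over s) \<le> g v"
  shows "runs peel_vertex s 24 (\<lambda>s'. scan_inv s' \<and> potential s' \<le> potential s)"
proof -
  have "v < n" "v \<notin> set (peeled s)"
    using v(2) peeled(3) by auto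
  define k where "k = nmem s 6 0 - 1"
  have "set (peeled s) \<subset> {..<n}"
    using peeling_distinct[OF peeled(2)] \<open>v < n\<close> \<open>v \<notin> set (peeled s)\<close> by (auto simp: verts_eq)
  then have "length (peeled s) < n"
    using psubset_card_mono[of "{..<n}" "set (peeled s)"] peeling_distinct[OF peeled(2)]
    by (simp add: distinct_card)
  then have k: "nmem s 6 0 = Suc k" "k < n"
    using peeled(1) by (auto simp: k_def peeled_def)
  \<comment> \<open>the state in which the program halts\<close>
  define s' where "s' = nstore 4 0 n (nstore 2 k v (nstore 6 0 k (nstore 3 v 1 s)))"
  have input': "holds_input s'"
    using input by (simp add: s'_def mem_simps holds_input_def)
  have peeled': "peeled s' = v # peeled s"
    using k by (simp add: peeled_def s'_def mem_simps upt_conv_Cons)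
  have left_over': "left_over s' = {..<n} - set (peeled s')"
    using peeled(3) unfolding peeled' by (auto simp: left_over_def s'_def mem_simps)
  have vals: "nmem s' 1 0 = 0" "nmem s' 4 0 = n" "nmem s' 6 0 = k"
    using input by (simp_all add: s'_def mem_simps)
  have "peeling D w g (peeled s')"
    using peeled bound \<open>v < n\<close> \<open>v \<notin> set (peeled s)\<close> by (simp add: peeled' verts_eq)
  then have "scan_inv s'"
    unfolding scan_inv_def using input' left_over' vals k by auto
  moreover have "potential s' \<le> potential s"
    using k by (simp add: potential_def vals)
  moreover have "nmem s 0 0 = n"
    using input by (simp add: holds_input_def)
  ultimately show ?thesis
    unfolding peel_vertex_def using v k
    apply -
    apply (rule runs_time)
     apply (rule runs_Seq runs_NSet)+
     apply (simp_all add: mem_simps s'_def)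
    done
qed

abbreviation within_bound :: test where
  "within_bound \<equiv> VLe (VGet 1 (NConst 0)) (VGet 0 (NAdd (NGet 0 (NConst 1)) (scalar 4)))"

lemma runs_examine_vertex:
  assumes inv: "scan_inv s" and pos: "nmem s 4 0 = Suc v"
  shows "runs examine_vertex s (60 * m + 150) (\<lambda>s'. scan_inv s' \<and> potential s' < potential s)"
proof -
  \<comment> \<open>the state after the first assignment, in which \<open>v\<close> is the vertex to be examined\<close>
  define s1 where "s1 = nstore 4 0 v s"
  have v: "v < n"
    using inv pos by (simp add: scan_inv_def)
  have eqs: "left_over s1 = left_over s" "peeled s1 = peeled s" "nmem s1 4 0 = v"
      "nmem s1 6 = nmem s 6" "nmem s1 1 = nmem s 1" "holds_input s1 = holds_input s"
    by (simp_all add: left_over_def peeled_def holds_input_def s1_def mem_simps fun_eq_iff)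
  have less: "potential s1 < potential s"
    using pos by (simp add: potential_def eqs)
  have next_inv: "scan_inv s1" if "v \<in> left_over s \<longrightarrow> g v < wdeg D w v (left_over s)"
  proof -
    have "g u < wdeg D w u (left_over s)" if "u \<in> left_over s" "Suc v \<le> u" for u
      using inv pos that by (auto simp: scan_inv_def)
    then have "\<forall>u\<in>left_over s. v \<le> u \<longrightarrow> g u < wdeg D w u (left_over s)"
      using that by (metis Suc_leI le_neq_implies_less)
    then show ?thesis
      using inv v unfolding scan_inv_def eqs by (intro conjI) auto
  qed
  have test: "runs (Cond within_bound peel_vertex Skip) s2 60
      (\<lambda>s'. scan_inv s' \<and> potential s' < potential s)"
    if v_left: "v \<in> left_over s" and same: "same_except_sum s1 s2"
      and wdeg: "vmem s2 1 0 = wdeg D w v (left_over s)" for s2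
  proof -
    note eqs2 = same_except_sum_simps[OF same] eqs
    have pot2: "potential s2 = potential s1"
      by (simp add: potential_def eqs2)
    have "holds_input s2"
      using inv by (simp add: scan_inv_def eqs2)
    then have "vmem s2 0 (m + v) = g v" "nmem s2 0 1 = m"
      using v by (simp_all add: holds_input_def)
    then have tval: "tval within_bound s2 \<longleftrightarrow> wdeg D w v (left_over s) \<le> g v"
      using wdeg eqs2 by simp
    show ?thesis
    proof (rule runs_time, rule runs_Cond)
      assume "tval within_bound s2"
      then have "wdeg D w v (left_over s) \<le> g v"
        unfolding tval .
      then have "runs peel_vertex s2 24 (\<lambda>s'. scan_inv s' \<and> potential s' \<le> potential s2)"
        using inv v_left
        by (intro runs_peel_vertex[where v = v])
          (auto simp: scan_inv_def eqs2 simp del: One_nat_def)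
      then show "runs peel_vertex s2 24 (\<lambda>s'. scan_inv s' \<and> potential s' < potential s)"
        by (rule runs_weaken) (use less pot2 in auto)
    next
      assume "\<not> tval within_bound s2"
      then have "g v < wdeg D w v (left_over s)"
        unfolding tval by simp
      then have "scan_inv s2"
        using scan_inv_same[OF next_inv same] by simp
      then show "runs Skip s2 1 (\<lambda>s'. scan_inv s' \<and> potential s' < potential s)"
        using less pot2 by (intro runs_Skip) simp
    qed simp
  qed
  have s1: "nstore 4 (nval (NConst 0) s) (nval (NSub (scalar 4) (NConst 1)) s) s = s1"
    using pos by (simp add: s1_def)
  have left: "tval (NLe (NGet 3 (scalar 4)) (NConst 0)) s1 \<longleftrightarrow> v \<in> left_over s"
    unfolding eqs(1)[symmetric] using v by (simp add: eqs(3)) (simp add: left_over_def)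
  show ?thesis
    unfolding examine_vertex_def
  proof (rule runs_time, rule runs_Seq, rule runs_NSet, unfold s1, rule runs_Cond, unfold left)
    assume "v \<in> left_over s"
    have "holds_input s1"
      using inv by (simp add: scan_inv_def eqs)
    from runs_sum_arcs[OF this]
    have "runs sum_arcs s1 (60 * m + 60) (\<lambda>s2. runs (Cond within_bound peel_vertex Skip) s2 60
        (\<lambda>s'. scan_inv s' \<and> potential s' < potential s))"
      by (rule runs_weaken) (use test \<open>v \<in> left_over s\<close> in \<open>simp_all add: eqs\<close>)
    then show "runs (Seq sum_arcs (Cond within_bound peel_vertex Skip)) s1 (60 * m + 60 + 60)
        (\<lambda>s'. scan_inv s' \<and> potential s' < potential s)"
      by (rule runs_Seq)
  next
    assume "v \<notin> left_over s"
    then show "runs Skip s1 1 (\<lambda>s'. scan_inv s' \<and> potential s' < potential s)"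
      using less next_inv by (intro runs_Skip) simp
  qed simp
qed

lemma runs_find_ordering:
  assumes "s = initial_mem (encode_instance (D, w, g))"
  shows "runs find_ordering s ((n * (n + 1) + n) * (60 * m + 160) + 100) (\<lambda>s'.
    case answer s' of None \<Rightarrow> bounded_orderings (D, w, g) = {}
    | Some \<sigma> \<Rightarrow> \<sigma> \<in> bounded_orderings (D, w, g))"
proof -
  let ?more = "NLe (NConst 1) (scalar 4)"
  have input: "holds_input s"
    using holds_input_initial assms by simp
  have zero: "nmem s x = (\<lambda>_. 0)" if "x \<noteq> 0" for x
    using assms that by (auto simp: initial_mem_def)
  have start: "scan_inv (nstore 4 0 n (nstore 6 0 n s))"
    using input zero unfolding scan_inv_def
    by (auto simp: holds_input_def left_over_def peeled_def mem_simps)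
  have loop: "runs (While ?more examine_vertex) (nstore 4 0 n (nstore 6 0 n s))
      ((n * (n + 1) + n) * (1 + tcost ?more + (60 * m + 150)) + (1 + tcost ?more))
      (\<lambda>s'. scan_inv s' \<and> \<not> tval ?more s')"
  proof (rule runs_While[where \<mu> = potential])
    fix s assume "scan_inv s" "tval ?more s"
    moreover from this obtain v where "nmem s 4 0 = Suc v"
      by (cases "nmem s 4 0") auto
    ultimately show "runs examine_vertex s (60 * m + 150)
        (\<lambda>s'. scan_inv s' \<and> potential s' < potential s)"
      using runs_examine_vertex by blast
  qed (use start in \<open>auto simp: potential_def mem_simps\<close>)
  have finish: "runs (Cond (NLe (scalar 6) (NConst 0))
      (Seq (NSet 1 (NConst 0) (NConst 1)) (NSet 1 (NConst 1) (scalar 0))) Skip) s' 20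
      (\<lambda>s'. case answer s' of None \<Rightarrow> bounded_orderings (D, w, g) = {}
        | Some \<sigma> \<Rightarrow> \<sigma> \<in> bounded_orderings (D, w, g))"
    if inv: "scan_inv s'" and stop: "\<not> tval ?more s'" for s'
  proof -
    let ?ys = "peeled s'"
    have peeling: "peeling D w g ?ys" and left: "left_over s' = {..<n} - set ?ys"
      and violated: "\<forall>u\<in>left_over s'. g u < wdeg D w u (left_over s')"
      and vals: "nmem s' 6 0 \<le> n" "nmem s' 0 0 = n" "nmem s' 1 0 = 0"
      using inv stop by (auto simp: scan_inv_def holds_input_def)
    have card: "card (set ?ys) = n - nmem s' 6 0"
      using peeling_distinct[OF peeling] by (simp add: distinct_card) (simp add: peeled_def)
    have found: "?ys \<in> bounded_orderings (D, w, g)" if "nmem s' 6 0 = 0"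
    proof -
      have "set ?ys = verts D"
        using card that peeling_distinct[OF peeling] by (intro card_subset_eq) (auto simp: verts_eq)
      then show ?thesis
        using peeling by (simp add: bounded_orderings_def peeling_imp_bounded_ordering)
    qed
    have stuck: "bounded_orderings (D, w, g) = {}" if "nmem s' 6 0 \<noteq> 0"
    proof -
      have "card (set ?ys) < card {..<n}"
        using card that vals(1) by simp
      then have "left_over s' \<noteq> {}"
        using card_mono[of "set ?ys" "{..<n}"] unfolding left by auto
      moreover have "left_over s' \<subseteq> verts D"
        by (auto simp: left_over_def verts_eq)
      ultimately have "\<not> bounded_ordering D w g \<sigma>" for \<sigma>
        using bounded_ordering_imp_not_obstructed[OF finite_arcs] violated
          wdeg_remove_self[OF loopfree_digraph_axioms] by (metis leD)
      then show ?thesis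
        by (simp add: bounded_orderings_def)
    qed
    show ?thesis
      apply (rule runs_time)
       apply (rule runs_Cond; (rule runs_Seq runs_NSet runs_Skip)+)
      using found stuck vals
      apply (auto simp: answer_def mem_simps nmem_nstore_other peeled_def)
      done
  qed
  have n: "nval (scalar 0) s = n" "nval (scalar 0) (nstore 6 0 n s) = n"
    using input by (auto simp: holds_input_def mem_simps)
  show ?thesis
    unfolding find_ordering_def
    apply (rule runs_time)
     apply (rule runs_Seq, rule runs_NSet)
     apply (rule runs_Seq, rule runs_NSet)
     apply (simp only: n nval.simps(1))
     apply (rule runs_Seq)
     apply (rule runs_weaken[OF loop order_refl])
     apply (rule finish)
    apply (auto simp: algebra_simps)
    done
qed

end

theorem bounded_ordering_solvable:
  "solvable_in_polynomial_time ordering_instances encode_instance bounded_orderings"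
proof -
  define p :: "nat poly" where
    "p = ([:0, 1:] * ([:0, 1:] + 1) + [:0, 1:]) * (60 * [:0, 1:] + 160) + 100"
  have p: "poly p N = (N * (N + 1) + N) * (60 * N + 160) + 100" for N
    by (simp add: p_def algebra_simps)
  have "\<exists>t s. exec find_ordering (initial_mem (encode_instance x)) t s \<and>
      t \<le> poly p (input_size (encode_instance x)) \<and>
      (case answer s of None \<Rightarrow> bounded_orderings x = {} | Some \<sigma> \<Rightarrow> \<sigma> \<in> bounded_orderings x)"
    if "x \<in> ordering_instances" for x
  proof -
    obtain D w g where x: "x = (D, w, g)"
      by (cases x)
    define n m where "n = card (verts D)" and "m = card (arcs D)"
    have "numbered_digraph D n m"
      using that unfolding x ordering_instances_def n_def m_def
      by (auto simp: numbered_digraph_def numbered_digraph_axioms_def)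
    then interpret numbered_digraph D w g n m .
    let ?N = "input_size (encode_instance x)"
    have "n \<le> ?N" "m \<le> ?N"
      by (auto simp: x input_size_eq)
    then have "(n * (n + 1) + n) * (60 * m + 160) + 100 \<le> poly p ?N"
      unfolding p by (intro add_mono mult_mono) auto
    from runs_time[OF runs_find_ordering[OF refl] this] show ?thesis
      unfolding runs_def x by blast
  qed
  then show ?thesis
    unfolding solvable_in_polynomial_time_def by blast
qed

theorem theorem2p2:
  fixes D :: "('a, 'b) pre_digraph"
    and w :: "'b \<Rightarrow> ennreal"
    and g :: "'a \<Rightarrow> ennreal"
  assumes "fin_digraph D" and "loopfree_digraph D"
  shows "solvable_in_polynomial_time ordering_instances encode_instance bounded_orderings \<and>
    ((\<exists>\<sigma>. bounded_ordering D w g \<sigma>) \<longleftrightarrow>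
      \<not> (\<exists>D'. induced_subgraph D' D \<and> verts D' \<noteq> {} \<and>
            (\<forall>v \<in> verts D'. wdeg D w v (verts D' - {v}) > g v)))"
  using bounded_ordering_solvable bounded_ordering_iff[OF assms] by blast

end
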